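(* For every positive integer $k$, the graph of a $\{1,2k\}$-leaper on a $(4k+2)\times(4k+2)$ board is Hamiltonian (has a cycle through every vertex exactly once).
   Context: For positive integers $r,s$, the graph of an $\{r,s\}$-leaper on an $m\times n$ board has vertex set $\{(x,y): 0\le x<m,\ 0\le y<n\}$ (integers), with an edge between $(x,y)$ and $(x',y')$ whenever $(x'-x,y'-y)\in\{(\pm r,\pm s),(\pm s,\pm r)\}$. *)

theory Defs
  imports Main "Graph_Theory.Graph_Theory"
begin

definition leaper_moves :: "nat \<Rightarrow> nat \<Rightarrow> (int \<times> int) set" where
  "leaper_moves r s =
     {int r, - int r} \<times> {int s, - int s} \<union> {int s, - int s} \<times> {int r, - int r}"

text \<open>An undirected edge is represented by its two opposite arcs.\<close>

definition leaper_graph :: "nat \<Rightarrow> nat \<Rightarrow> nat \<Rightarrow> nat \<Rightarrow> (int \<times> int) pair_pre_digraph" where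
  "leaper_graph r s m n =
     (let V = {0..<int m} \<times> {0..<int n} in
      \<lparr> pverts = V,
        parcs = {((x, y), (x', y')) | x y x' y'.
                   (x, y) \<in> V \<and> (x', y') \<in> V \<and> (x' - x, y' - y) \<in> leaper_moves r s} \<rparr>)"

text \<open>
  \<^const>\<open>pre_digraph.cycle\<close> already demands that no vertex is repeated (apart from the coinciding
  end points), so spanning means that each vertex is met exactly once. The bound on the length
  excludes the closed walk that goes back and forth along a single undirected edge, which
  \<^const>\<open>pre_digraph.cycle\<close> would accept.
\<close>

definition hamiltonian :: "('a, 'b) pre_digraph \<Rightarrow> bool" where
  "hamiltonian G \<longleftrightarrow>
     (\<exists>p. pre_digraph.cycle G p \<and> 3 \<le> length p \<and> tail G ` set p = verts G)"

lemma in_parcs_leaper_graph: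
  "(u, v) \<in> parcs (leaper_graph r s m n) \<longleftrightarrow>
     u \<in> pverts (leaper_graph r s m n) \<and> v \<in> pverts (leaper_graph r s m n) \<and>
     (fst v - fst u, snd v - snd u) \<in> leaper_moves r s"
  by (cases u; cases v) (simp add: leaper_graph_def Let_def)

lemma leaper_moves_uminus:
  assumes "(a, b) \<in> leaper_moves r s"
  shows "(- a, - b) \<in> leaper_moves r s"
proof -
  have "- x \<in> {c, - c}" if "x \<in> {c, - c}" for x c :: int
    using that by auto
  then show ?thesis
    using assms unfolding leaper_moves_def by blast
qed

lemma pair_graph_leaper_graph:
  assumes "0 < r" "0 < s"
  shows "pair_graph (leaper_graph r s m n)"
proof -
  let ?G = "leaper_graph r s m n"
  have fin: "finite (pverts ?G)"
    by (simp add: leaper_graph_def Let_def)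
  have sub: "fst e \<in> pverts ?G" "snd e \<in> pverts ?G" if "e \<in> parcs ?G" for e
    using that in_parcs_leaper_graph[of "fst e" "snd e"] by simp_all
  then have "parcs ?G \<subseteq> pverts ?G \<times> pverts ?G"
    by (auto simp: mem_Times_iff)
  then have fin': "finite (parcs ?G)"
    using fin finite_subset by blast
  have "(0, 0) \<notin> leaper_moves r s"
    using assms by (simp add: leaper_moves_def)
  then have loop: "fst e \<noteq> snd e" if "e \<in> parcs ?G" for e
    using that in_parcs_leaper_graph[of "fst e" "snd e"] by auto
  have "(v, u) \<in> parcs ?G" if "(u, v) \<in> parcs ?G" for u v
    using that leaper_moves_uminus[of "fst v - fst u" "snd v - snd u" r s]
    by (simp add: in_parcs_leaper_graph)
  then have "sym (parcs ?G)"
    by (rule symI)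
  then have sym: "symmetric (with_proj ?G)"
    by (simp add: symmetric_def arcs_ends_def arc_to_ends_def)
  show ?thesis
    by unfold_locales (fact sub fin fin' loop sym)+
qed

end

(*
  Apart from two strips along its borders, the board is covered by four disjoint square grids of
  k x k blocks of size 2 x 2, whose grid edges are moves of the leaper. The first blocks of the grids
  and the ends of the strips form 36 cells, on which a closed knight's tour of the 6 x 6 board gives
  a cycle; four of its edges are moves of the leaper only if k = 1. The remaining cells are inserted
  in small groups (a block of a grid, or two cells of a strip), each time replacing an edge u v of
  the cycle by a path from u to v through the new cells. In each grid the order follows a spanning
  tree of the blocks, and the four false edges are removed by inserting the first row or the first
  column of blocks of a grid between their ends.
*)

theory Submission
  imports Defs
begin

section \<open>Cycles and ears\<close>

fun path_edges :: "'a list \<Rightarrow> 'a set set" where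
  "path_edges (x # y # zs) = insert {x, y} (path_edges (y # zs))"
| "path_edges _ = {}"

definition cycle_edges :: "'a list \<Rightarrow> 'a set set" where
  "cycle_edges p = insert {last p, hd p} (path_edges p)"

text \<open>\<open>E\<close> is the exact edge set, so that insertions become set operations that do
  not depend on the starting point or the direction of the cycle.\<close>

definition spanning_cycle :: "'a set \<Rightarrow> 'a set set \<Rightarrow> bool" where
  "spanning_cycle V E \<longleftrightarrow>
     (\<exists>p. distinct p \<and> 3 \<le> length p \<and> set p = V \<and> cycle_edges p = E)"

lemma path_edges_append:
  assumes "xs \<noteq> []" "ys \<noteq> []"
  shows "path_edges (xs @ ys) = path_edges xs \<union> path_edges ys \<union> {{last xs, hd ys}}"
  using assms
proof (induction xs)
  case (Cons x xs)
  then show ?case by (cases xs; cases ys) auto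
qed simp

lemma path_edges_Cons: "ys \<noteq> [] \<Longrightarrow> path_edges (x # ys) = insert {x, hd ys} (path_edges ys)"
  by (cases ys) auto

lemma path_edges_rev: "path_edges (rev xs) = path_edges xs"
proof (induction xs rule: path_edges.induct)
  case (1 x y zs)
  have "path_edges (rev (x # y # zs)) = path_edges (rev (y # zs) @ [x])" by simp
  also have "\<dots> = path_edges (rev (y # zs)) \<union> {{y, x}}"
    by (subst path_edges_append) auto
  finally show ?case using 1 by (auto simp: insert_commute)
qed simp_all

lemma cycle_edges_rev: "p \<noteq> [] \<Longrightarrow> cycle_edges (rev p) = cycle_edges p"
  by (auto simp: cycle_edges_def path_edges_rev last_rev hd_rev insert_commute)

lemma path_edges_subset: "e \<in> path_edges p \<Longrightarrow> e \<subseteq> set p"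
  by (induction p rule: path_edges.induct) auto

lemma cycle_edges_subset: "e \<in> cycle_edges p \<Longrightarrow> p \<noteq> [] \<Longrightarrow> e \<subseteq> set p"
  using path_edges_subset[of e p] by (auto simp: cycle_edges_def)

lemma path_edges_split:
  "{a, b} \<in> path_edges p \<Longrightarrow> \<exists>ys zs. p = ys @ a # b # zs \<or> p = ys @ b # a # zs"
proof (induction p rule: path_edges.induct)
  case (1 x y zs)
  show ?case
  proof (cases "{a, b} = {x, y}")
    case True
    then show ?thesis by (metis append_Nil doubleton_eq_iff)
  next
    case False
    then obtain ys ws where "y # zs = ys @ a # b # ws \<or> y # zs = ys @ b # a # ws"
      using 1 by auto
    then show ?thesis by (metis append_Cons)
  qed
qed auto

lemma cycle_edges_rotate:
  assumes "ys \<noteq> []" "zs \<noteq> []"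
  shows "cycle_edges (ys @ zs) = cycle_edges (zs @ ys)"
  using assms by (auto simp: cycle_edges_def path_edges_append)

text \<open>Rotating the list makes the given edge the closing one, and reversing it corrects the
  direction if necessary.\<close>

lemma cycle_edge_open:
  assumes "{a, b} \<in> cycle_edges p" "3 \<le> length p" "distinct p"
  obtains q where "set q = set p" "distinct q" "length q = length p"
    "cycle_edges q = cycle_edges p" "hd q = b" "last q = a"
proof -
  have "\<exists>q. set q = set p \<and> distinct q \<and> length q = length p \<and> cycle_edges q = cycle_edges p
      \<and> {hd q, last q} = {a, b} \<and> hd q \<noteq> last q"
  proof (cases "{a, b} = {last p, hd p}")
    case True
    have "hd p \<noteq> last p" using assms(2,3) by (cases p) auto
    then show ?thesis using True assms by (intro exI[of _ p]) auto
  next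
    case False
    then have "{a, b} \<in> path_edges p" using assms(1) by (simp add: cycle_edges_def)
    then obtain ys zs where "p = ys @ a # b # zs \<or> p = ys @ b # a # zs"
      using path_edges_split[of a b p] by blast
    then obtain c d where p: "p = ys @ c # d # zs" and cd: "{c, d} = {a, b}"
      by (elim disjE) (fastforce simp: insert_commute)+
    let ?q = "(d # zs) @ (ys @ [c])"
    have "cycle_edges ?q = cycle_edges ((ys @ [c]) @ (d # zs))"
      by (rule cycle_edges_rotate) auto
    then have "cycle_edges ?q = cycle_edges p" using p by simp
    then show ?thesis using p cd assms(3) by (intro exI[of _ ?q]) auto
  qed
  then obtain q where q: "set q = set p" "distinct q" "length q = length p"
    "cycle_edges q = cycle_edges p" "{hd q, last q} = {a, b}" by blast
  have ne: "q \<noteq> []" using q(3) assms(2) by auto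
  show thesis
  proof (cases "hd q = b \<and> last q = a")
    case True
    then show ?thesis using q that by blast
  next
    case False
    then have "hd q = a" "last q = b" using q(5) by (auto simp: doubleton_eq_iff)
    then show ?thesis using q ne that[of "rev q"]
      by (simp add: cycle_edges_rev hd_rev last_rev)
  qed
qed

text \<open>In a list without repetitions the two ends can only be neighbours if there are just two
  entries. Hence deleting the closing edge of a cycle leaves exactly its path edges.\<close>

lemma path_edges_no_closing:
  assumes "distinct q" "3 \<le> length q"
  shows "{last q, hd q} \<notin> path_edges q"
proof
  assume *: "{last q, hd q} \<in> path_edges q"
  obtain ys zs where split: "q = ys @ last q # hd q # zs \<or> q = ys @ hd q # last q # zs"
    using path_edges_split[OF *] by (elim exE)
  obtain x m y where q: "q = x # m @ [y]" "m \<noteq> []"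
  proof -
    obtain x r where r: "q = x # r" using assms(2) by (cases q) auto
    then have "r \<noteq> []" using assms(2) by auto
    obtain m y where m: "r = m @ [y]" using \<open>r \<noteq> []\<close> by (cases r rule: rev_cases) auto
    have "m \<noteq> []" using assms(2) r m by auto
    then show thesis using that[of x m y] r m by simp
  qed
  have "x # m @ [y] = ys @ y # x # zs \<or> x # m @ [y] = ys @ x # y # zs"
    using split unfolding q(1) by simp
  moreover have d: "distinct (x # m @ [y])" using assms(1) q(1) by simp
  moreover have "x \<notin> set (m @ [y])" using d by simp
  moreover have "m \<noteq> [] \<Longrightarrow> m @ [y] \<noteq> y # zs" using d by (cases m) auto
  moreover have "x \<in> set (m @ [y])" if "m @ [y] = ys' @ y # x # zs \<or> m @ [y] = ys' @ x # y # zs" for ys'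
    using arg_cong[of _ _ set] that by fastforce
  ultimately show False using q(2) by (cases ys) auto
qed

section \<open>Inserting ears into a cycle\<close>

lemma spanning_cycle_add_ear:
  assumes cyc: "spanning_cycle V E" and uv: "{u, v} \<in> E"
    and P: "P \<noteq> []" "distinct P" "set P \<inter> V = {}"
  shows "spanning_cycle (V \<union> set P) ((E - {{u, v}}) \<union> path_edges (u # P @ [v]))"
proof -
  obtain p where p: "distinct p" "3 \<le> length p" "set p = V" "cycle_edges p = E"
    using cyc by (auto simp: spanning_cycle_def)
  \<comment> \<open>Opened at the base edge, the cycle runs from \<open>v\<close> to
    \<open>u\<close>, and \<open>P\<close> can be appended.\<close>
  obtain q where q: "set q = set p" "distinct q" "length q = length p"
    "cycle_edges q = cycle_edges p" "hd q = v" "last q = u"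
    using cycle_edge_open[of u v p] uv p by metis
  have ne: "q \<noteq> []" using q p by auto
  have E: "path_edges q = E - {{u, v}}"
    using path_edges_no_closing[of q] q p by (auto simp: cycle_edges_def)
  have "path_edges (u # P @ [v]) = insert {u, hd P} (path_edges P \<union> {{last P, v}})"
    using P(1) by (simp add: path_edges_append path_edges_Cons)
  moreover have "cycle_edges (q @ P) = insert {last P, v} (path_edges q \<union> path_edges P \<union> {{u, hd P}})"
    using P(1) ne q by (simp add: cycle_edges_def path_edges_append)
  ultimately have "cycle_edges (q @ P) = (E - {{u, v}}) \<union> path_edges (u # P @ [v])"
    using E by auto
  then show ?thesis unfolding spanning_cycle_def
    using p q P by (intro exI[of _ "q @ P"]) auto
qed

lemma spanning_cycle_edge_subset: "spanning_cycle V E \<Longrightarrow> e \<in> E \<Longrightarrow> e \<subseteq> V"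
  using cycle_edges_subset by (fastforce simp: spanning_cycle_def)

lemma path_edges_ear_meets:
  "P \<noteq> [] \<Longrightarrow> e \<in> path_edges (u # P @ [v]) \<Longrightarrow> e \<inter> set P \<noteq> {}"
proof -
  have *: "Q \<noteq> [] \<Longrightarrow> e \<in> path_edges (Q @ [v]) \<Longrightarrow> e \<inter> set Q \<noteq> {}" for Q
    by (induction Q rule: path_edges.induct) auto
  show "P \<noteq> [] \<Longrightarrow> e \<in> path_edges (u # P @ [v]) \<Longrightarrow> e \<inter> set P \<noteq> {}"
    using *[of P] by (cases P) auto
qed

text \<open>The rank only says in which order the ears can be inserted: the base edge of an ear
  must be present when its turn comes, and distinctness of the base edges says that it has not been
  used up before.\<close>

lemma spanning_cycle_add_ears:
  fixes r :: "'i \<Rightarrow> nat" and u v :: "'i \<Rightarrow> 'a" and P :: "'i \<Rightarrow> 'a list"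
  assumes "finite I" "spanning_cycle V E"
    and "\<And>e. e \<in> I \<Longrightarrow> P e \<noteq> [] \<and> distinct (P e) \<and> set (P e) \<inter> V = {}"
    and "\<And>e e'. e \<in> I \<Longrightarrow> e' \<in> I \<Longrightarrow> e \<noteq> e' \<Longrightarrow> set (P e) \<inter> set (P e') = {}"
    and "\<And>e. e \<in> I \<Longrightarrow> {u e, v e} \<in> E \<or>
           (\<exists>e'\<in>I. r e' < r e \<and> {u e, v e} \<in> path_edges (u e' # P e' @ [v e']))"
    and "inj_on (\<lambda>e. {u e, v e}) I"
  shows "spanning_cycle (V \<union> (\<Union>e\<in>I. set (P e)))
           ((E \<union> (\<Union>e\<in>I. path_edges (u e # P e @ [v e]))) - (\<lambda>e. {u e, v e}) ` I)"
  using assms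
proof (induction "card I" arbitrary: I)
  case 0
  then show ?case by simp
next
  case (Suc n)
  let ?b = "\<lambda>e. {u e, v e}" and ?ee = "\<lambda>e. path_edges (u e # P e @ [v e])"
  have "I \<noteq> {}" using Suc.hyps(2) by auto
  \<comment> \<open>An ear \<open>m\<close> of maximal rank is inserted last: no other ear has its
    base edge supplied by \<open>m\<close>.\<close>
  then have "Max (r ` I) \<in> r ` I" using Suc.prems(1) by auto
  then obtain m where "m \<in> I" and m: "\<And>e. e \<in> I \<Longrightarrow> r e \<le> r m"
    using Suc.prems(1) by (metis (no_types, lifting) Max_ge finite_imageI imageE imageI)
  define J where "J = I - {m}"
  have I: "I = insert m J" "m \<notin> J" using \<open>m \<in> I\<close> by (auto simp: J_def)
  define V' where "V' = V \<union> (\<Union>e\<in>J. set (P e))"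
  define E' where "E' = (E \<union> (\<Union>e\<in>J. ?ee e)) - ?b ` J"
  have early: "?b e \<in> E \<or> (\<exists>e'\<in>J. r e' < r e \<and> ?b e \<in> ?ee e')" if "e \<in> I" for e
  proof -
    have "r e \<le> r m" using m that by blast
    then show ?thesis using Suc.prems(5)[OF that] by (auto simp: J_def)
  qed
  have inj: "inj_on ?b J" using Suc.prems(6) I by (auto simp: inj_on_def)
  have cyc: "spanning_cycle V' E'"
    unfolding V'_def E'_def
  proof (rule Suc.hyps(1))
    show "n = card J" using Suc.hyps(2) I Suc.prems(1) by simp
    show "finite J" using Suc.prems(1) by (simp add: J_def)
    show "spanning_cycle V E" by fact
    fix e e'
    assume e: "e \<in> J"
    show "P e \<noteq> [] \<and> distinct (P e) \<and> set (P e) \<inter> V = {}" using Suc.prems(3) e I by blast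
    show "?b e \<in> E \<or> (\<exists>e'\<in>J. r e' < r e \<and> ?b e \<in> ?ee e')" using early e I by blast
    assume "e' \<in> J" "e \<noteq> e'"
    then show "set (P e) \<inter> set (P e') = {}" using Suc.prems(4) e I by blast
  qed (fact inj)
  have Pm: "P m \<noteq> []" "distinct (P m)" "set (P m) \<inter> V' = {}"
    using Suc.prems(3)[OF \<open>m \<in> I\<close>] Suc.prems(4)[OF \<open>m \<in> I\<close>] I by (auto simp: V'_def)
  have "?b m \<in> E \<union> (\<Union>e\<in>J. ?ee e)" using early[OF \<open>m \<in> I\<close>] by blast
  moreover have "?b m \<notin> ?b ` J" using Suc.prems(6) I by (auto simp: inj_on_def)
  ultimately have bm: "?b m \<in> E'" by (simp add: E'_def)
  have "\<exists>x\<in>e. x \<in> set (P m)" if "e \<in> ?ee m" for e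
    using path_edges_ear_meets[OF Pm(1) that] by blast
  then have sep: "\<not> e \<subseteq> V'" if "e \<in> ?ee m" for e using Pm(3) that by blast
  \<comment> \<open>Old edges lie inside \<open>V'\<close> while those of the ear \<open>m\<close>
    do not, so the two sets of edges are disjoint. Edges that were already replaced are missing from
    \<open>E'\<close>; for them the claim follows by induction on the rank.\<close>
  have sub: "e \<subseteq> V'" if "e \<in> E \<union> (\<Union>e\<in>J. ?ee e)" for e
  proof -
    have E: "f \<subseteq> V" if "f \<in> E" for f
      using that spanning_cycle_edge_subset[OF Suc.prems(2)] by blast
    have base: "?b f \<subseteq> V'" if "f \<in> J" for f
    proof (cases "?b f \<in> E")
      case True
      then show ?thesis using E by (auto simp: V'_def)
    next
      case False
      have "f \<in> I" using that I by blast
      then show ?thesis using that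
      proof (induction "r f" arbitrary: f rule: less_induct)
        case less
        show ?case
        proof (cases "?b f \<in> E")
          case True
          then show ?thesis using E by (auto simp: V'_def)
        next
          case False
          then obtain g where g: "g \<in> J" "r g < r f" "?b f \<in> ?ee g"
            using early[OF less.prems(1)] by blast
          have "?b g \<subseteq> V'" using less.hyps[OF g(2)] g(1) I by blast
          moreover have "?b f \<subseteq> set (u g # P g @ [v g])" using path_edges_subset g(3) by metis
          ultimately show ?thesis using g(1) by (auto simp: V'_def)
        qed
      qed
    qed
    show ?thesis
    proof (cases "e \<in> E")
      case True
      then show ?thesis using E by (auto simp: V'_def)
    next
      case False
      then obtain g where g: "g \<in> J" "e \<in> ?ee g" using \<open>e \<in> _\<close> by blast
      then have "e \<subseteq> set (u g # P g @ [v g])" using path_edges_subset by metis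
      then show ?thesis using g(1) base[OF g(1)] by (auto simp: V'_def)
    qed
  qed
  have "?ee m \<inter> ?b ` J = {}"
  proof -
    have "?b e \<subseteq> V'" if "e \<in> J" for e
      using sub early[of e] that I by blast
    then show ?thesis using sep by blast
  qed
  moreover have "?b m \<notin> ?ee m" using sep sub bm by (auto simp: E'_def)
  ultimately have eq: "(E' - {?b m}) \<union> ?ee m = (E \<union> (\<Union>e\<in>I. ?ee e)) - ?b ` I"
    by (auto simp: E'_def I(1))
  have "spanning_cycle (V' \<union> set (P m)) ((E' - {?b m}) \<union> ?ee m)"
    by (rule spanning_cycle_add_ear[OF cyc bm Pm])
  moreover have "V' \<union> set (P m) = V \<union> (\<Union>e\<in>I. set (P e))" by (auto simp: V'_def I(1))
  ultimately show ?case unfolding eq by simp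
qed

section \<open>Ears in the leaper graph\<close>

text \<open>The triple \<open>(c, i, b)\<close> stands for the coordinate \<open>2 k c + 2 i + b\<close>, where \<open>i < k\<close> and
  \<open>c \<le> 2\<close>, and \<open>i = 0\<close> if \<open>c = 2\<close>.\<close>

type_synonym coord = "nat \<times> nat \<times> bool"

text \<open>Names \<open>2 k c + 2 i + b\<close> also for \<open>i = k\<close>, where the index
  carries over into the next \<open>c\<close>. This lets a grid reach one block beyond its
  \<open>k\<close> by \<open>k\<close> blocks.\<close>

definition coord :: "nat \<Rightarrow> bool \<Rightarrow> nat \<Rightarrow> bool \<Rightarrow> coord" where
  "coord k c i b = (if i < k then (of_bool c, i, b) else (of_bool c + 1, i - k, b))"

text \<open>For each \<open>(p, q)\<close> this is a homomorphism from the \<open>(2k + 2) \<times> (2k + 2)\<close> grid, with its points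
  written as \<open>(2 i + x, 2 j + y)\<close>, to the leaper graph: a step in \<open>x\<close> changes the first coordinate
  by 1 and, through \<open>q \<noteq> x\<close>, the second one by \<open>2 k\<close>. The four grids cover the board, and they
  overlap only near their borders.\<close>

definition cell :: "nat \<Rightarrow> bool \<Rightarrow> bool \<Rightarrow> nat \<Rightarrow> bool \<Rightarrow> nat \<Rightarrow> bool \<Rightarrow> coord \<times> coord" where
  "cell k p q i x j y = (coord k (p \<noteq> y) i x, coord k (q \<noteq> x) j y)"

text \<open>A \<open>Block\<close> has the four points of a grid with given \<open>i\<close> and
  \<open>j\<close>. A \<open>Horizontal\<close> or \<open>Vertical\<close> ear has two cells of the
  strip where the first or the second coordinate is at least \<open>4 k\<close>; the names refer to
  the grid direction of the base edge.\<close>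

datatype ear = Block bool bool nat nat | Horizontal bool bool nat | Vertical bool bool nat

text \<open>\<open>Row\<close> and \<open>Column\<close> mark blocks that are inserted into a false
  edge, between the preceding block and the far end with index \<open>k\<close>. The Boolean is the
  parity that is constant along that edge.\<close>

datatype side = Left | Right | Below | Above | Row bool | Column bool

text \<open>The side on which a block is attached to an earlier one. The choice has to keep free the
  edges of the blocks \<open>(0, j)\<close> and \<open>(i, 0)\<close> at which the cells of the strips are inserted, and no
  corner block needs a free edge at the start: the grids \<open>(True, True)\<close>, \<open>(True, False)\<close> and
  \<open>(False, False)\<close> are entered, in this order, from cells of a strip that were inserted at the
  preceding grid, the first one being \<open>(False, True)\<close>.\<close>

fun block_side :: "bool \<Rightarrow> bool \<Rightarrow> nat \<Rightarrow> nat \<Rightarrow> side" where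
  "block_side False True i j = (if j = 0 then Row False else if i = 0 then Column False else Left)"
| "block_side True True i j =
     (if i = 0 then Column True else if j = 0 then Above else if j = 1 then Right else Below)"
| "block_side True False i j =
     (if i = 1 then Above else if i = 0 then Right else if j = 0 then Above else Left)"
| "block_side False False i j =
     (if j = 0 then Row True else if j = 1 \<or> i = 0 then Right else Below)"

text \<open>A list \<open>u # P @ [v]\<close> is given as \<open>(u, P, v)\<close>. In the base edge \<open>u v\<close> the parity that changes
  is always \<open>False\<close> in \<open>u\<close>.\<close>

fun ear_path :: "nat \<Rightarrow> ear \<Rightarrow> (coord \<times> coord) \<times> (coord \<times> coord) list \<times> (coord \<times> coord)" where
  "ear_path k (Block p q i j) = (let c = cell k p q in
     case block_side p q i j of
       Left \<Rightarrow> (c (i - 1) True j False,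
         [c i False j False, c i True j False, c i True j True, c i False j True],
         c (i - 1) True j True)
     | Right \<Rightarrow> (c (i + 1) False j False,
         [c i True j False, c i False j False, c i False j True, c i True j True],
         c (i + 1) False j True)
     | Below \<Rightarrow> (c i False (j - 1) True,
         [c i False j False, c i False j True, c i True j True, c i True j False],
         c i True (j - 1) True)
     | Above \<Rightarrow> (c i False (j + 1) False,
         [c i False j True, c i False j False, c i True j False, c i True j True],
         c i True (j + 1) False)
     | Row y \<Rightarrow> (c k False 0 y,
         [c i True 0 y, c i True 0 (\<not> y), c i False 0 (\<not> y), c i False 0 y],
         c (i - 1) True 0 y)
     | Column x \<Rightarrow> (c 0 x k False,
         [c 0 x j True, c 0 (\<not> x) j True, c 0 (\<not> x) j False, c 0 x j False],
         c 0 x (j - 1) True))"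
| "ear_path k (Horizontal p q j) = (let c = cell k p q in
     (c k False j p, [c k False j (\<not> p), c k True j (\<not> p)], c k True j p))"
| "ear_path k (Vertical p q i) = (let c = cell k p q in
     (c i q k False, [c i (\<not> q) k False, c i (\<not> q) k True], c i q k True))"

definition ears :: "nat \<Rightarrow> ear set" where
  "ears k = {Block p q i j | p q i j. i < k \<and> j < k \<and> (i, j) \<noteq> (0, 0)}
     \<union> {Horizontal p q j | p q j. 0 < j \<and> j < k} \<union> {Vertical p q i | p q i. 0 < i \<and> i < k}"

lemma in_ears [simp]:
  "Block p q i j \<in> ears k \<longleftrightarrow> i < k \<and> j < k \<and> (0 < i \<or> 0 < j)"
  "Horizontal p q j \<in> ears k \<longleftrightarrow> 0 < j \<and> j < k"
  "Vertical p q j \<in> ears k \<longleftrightarrow> 0 < j \<and> j < k"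
  by (auto simp: ears_def)

text \<open>The multiples of \<open>k\<close> separate the stages of the insertion. A subtracted
  \<open>i\<close> or \<open>j\<close> belongs to blocks that are attached to the neighbour of
  higher index.\<close>

fun ear_rank :: "nat \<Rightarrow> ear \<Rightarrow> nat" where
  "ear_rank k (Block False True i j) = i + j"
| "ear_rank k (Horizontal True True j) = 3 * k"
| "ear_rank k (Block True True i j) =
     (if i = 0 then j else if j = 0 then 6 * k else if j = 1 then 5 * k - i else 6 * k + j)"
| "ear_rank k (Horizontal False True j) = 6 * k"
| "ear_rank k (Vertical True False i) = 8 * k"
| "ear_rank k (Block True False i j) =
     (if i = 1 then 10 * k - j else if i = 0 then 11 * k else if j = 0 then 13 * k else 11 * k + i)"
| "ear_rank k (Horizontal False False j) = 14 * k"
| "ear_rank k (Vertical True True i) = 14 * k"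
| "ear_rank k (Block False False i j) =
     (if j = 0 then i else if j = 1 then 16 * k - i else if i = 0 then 19 * k else 17 * k + j)"
| "ear_rank k (Horizontal True False j) = 20 * k"
| "ear_rank k (Vertical False q i) = 20 * k"

abbreviation (input) ear_start where "ear_start k e \<equiv> fst (ear_path k e)"
abbreviation (input) ear_inner where "ear_inner k e \<equiv> fst (snd (ear_path k e))"
abbreviation (input) ear_end where "ear_end k e \<equiv> snd (snd (ear_path k e))"

definition ear_edges :: "nat \<Rightarrow> ear \<Rightarrow> (coord \<times> coord) set set" where
  "ear_edges k e = path_edges (ear_start k e # ear_inner k e @ [ear_end k e])"

definition ear_base :: "nat \<Rightarrow> ear \<Rightarrow> (coord \<times> coord) set" where
  "ear_base k e = {ear_start k e, ear_end k e}"

text \<open>This is a closed knight's tour on the 6 by 6 board. It uses four edges that join \<open>2 i + 1\<close> and \<open>2 i + 2\<close>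
  and which are therefore not available when \<open>k > 1\<close>; they serve as base edges.\<close>

definition tour :: "(coord \<times> coord) list" where
  "tour = map (\<lambda>(x, y). ((x div 2, 0, odd x), (y div 2, 0, odd y)))
     [(0, 0), (1, 2), (0, 4), (2, 3), (0, 2), (1, 4), (3, 5), (5, 4), (4, 2), (5, 0), (3, 1), (1, 0), (2, 2), (0, 3), (1, 5), 
      (3, 4), (5, 5), (4, 3), (5, 1), (3, 0), (1, 1), (3, 2), (2, 0), (0, 1), (1, 3), (0, 5), (2, 4), (4, 5), (5, 3), (4, 1), (3, 3), (2, 5), (4, 4), (5, 2), (4, 0), (2, 1)]"

lemmas ear_simps = coord_def cell_def Let_def

lemma finite_ears: "finite (ears k)"
proof -
  have "ears k \<subseteq> (\<Union>p. \<Union>q. \<Union>i\<in>{..<k}. \<Union>j\<in>{..<k}. {Block p q i j})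
    \<union> (\<Union>p. \<Union>q. \<Union>i\<in>{..<k}. {Horizontal p q i, Vertical p q i})"
    by (auto simp: ears_def)
  then show ?thesis by (rule finite_subset) auto
qed

lemma ears_cases [consumes 1, case_names Block Horizontal Vertical]:
  assumes "e \<in> ears k"
    and "\<And>p q i j. e = Block p q i j \<Longrightarrow> i < k \<Longrightarrow> j < k \<Longrightarrow> 0 < i \<or> 0 < j \<Longrightarrow> thesis"
    and "\<And>p q j. e = Horizontal p q j \<Longrightarrow> 0 < j \<Longrightarrow> j < k \<Longrightarrow> thesis"
    and "\<And>p q i. e = Vertical p q i \<Longrightarrow> 0 < i \<Longrightarrow> i < k \<Longrightarrow> thesis"
  shows thesis
  using assms by (auto simp: ears_def)

section \<open>Disjointness of the ears from each other and from the tour\<close>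

fun ear_of :: "coord \<times> coord \<Rightarrow> ear" where
  "ear_of ((c, i, x), (d, j, y)) =
     (if c = 2 then Horizontal (\<not> y) ((d = 1) \<noteq> x) j
      else if d = 2 then Vertical ((c = 1) \<noteq> y) (\<not> x) i
      else Block ((c = 1) \<noteq> y) ((d = 1) \<noteq> x) i j)"

lemma side_Row: "block_side p q i j = Row y \<Longrightarrow> j = 0"
  by (cases p; cases q) (auto split: if_splits)

lemma side_Column: "block_side p q i j = Column y \<Longrightarrow> i = 0"
  by (cases p; cases q) (auto split: if_splits)

lemma ear_inner_Block:
  assumes "v \<in> set (ear_inner k (Block p q i j))"
  obtains x y where "v = cell k p q i x j y"
  using assms by (auto simp: Let_def split: side.splits dest: side_Row side_Column)

text \<open>An ear can be read off from any of its new cells, so different ears have no new cell in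
  common.\<close>

lemma ear_of_inner:
  assumes "e \<in> ears k" "v \<in> set (ear_inner k e)"
  shows "ear_of v = e"
  using assms(1)
proof (cases rule: ears_cases)
  case (Block p q i j)
  then obtain x y where "v = cell k p q i x j y"
    using ear_inner_Block assms(2) by metis
  then show ?thesis using Block by (auto simp: ear_simps)
next
  case (Horizontal p q j)
  then show ?thesis using assms(2) by (auto simp: ear_simps)
next
  case (Vertical p q i)
  then show ?thesis using assms(2) by (auto simp: ear_simps)
qed

text \<open>Separates the ears from the tour, whose cells have both indices 0.\<close>

lemma inner_nonzero:
  assumes "e \<in> ears k" "((c, i, x), (d, j, y)) \<in> set (ear_inner k e)"
  shows "0 < i \<or> 0 < j"
  using ear_of_inner[OF assms] assms(1) by (auto simp: ears_def split: if_splits)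

lemma cell_eqD: "cell k p q i x j y = cell k p' q' i' x' j' y' \<Longrightarrow> x = x' \<and> y = y'"
  by (simp add: ear_simps split: if_splits)

lemma ear_inner_distinct: "ear_inner k e \<noteq> [] \<and> distinct (ear_inner k e)"
proof (cases e)
  case (Block p q i j)
  then show ?thesis by (cases "block_side p q i j") (auto simp: Let_def dest!: cell_eqD)
qed (auto simp: Let_def dest!: cell_eqD)

lemma tour_zero: "((c, i, x), (d, j, y)) \<in> set tour \<Longrightarrow> i = 0 \<and> j = 0"
  by (auto simp: tour_def)

lemma spanning_cycle_tour: "spanning_cycle (set tour) (cycle_edges tour)"
  unfolding spanning_cycle_def by (rule exI[of _ tour]) (simp add: tour_def)



section \<open>Distinctness of the base edges\<close>

definition parity_weight :: "coord \<times> coord \<Rightarrow> nat" where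
  "parity_weight v = of_bool (snd (snd (fst v))) + of_bool (snd (snd (snd v)))"

lemma parity_weight_cell [simp]: "parity_weight (cell k p q i x j y) = of_bool x + of_bool y"
  by (simp add: parity_weight_def ear_simps)

text \<open>The weight orients the base edges, so that equality of two such unordered pairs yields
  equality of their ends in order.\<close>

lemma parity_weight_base: "parity_weight (ear_start k e) < parity_weight (ear_end k e)"
proof (cases e)
  case (Block p q i j)
  then show ?thesis by (cases "block_side p q i j") (auto simp: Let_def)
qed (auto simp: Let_def)

lemma ear_base_eqD:
  assumes "ear_base k e = ear_base k e'"
  shows "ear_start k e = ear_start k e'" "ear_end k e = ear_end k e'"
  using assms parity_weight_base[of k e] parity_weight_base[of k e']
  by (auto simp: ear_base_def doubleton_eq_iff)

lemma ear_ends_Block_inj: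
  assumes "i < k" "j < k" "0 < i \<or> 0 < j" "i' < k" "j' < k" "0 < i' \<or> 0 < j'"
    and "ear_start k (Block p q i j) = ear_start k (Block p' q' i' j')"
    and "ear_end k (Block p q i j) = ear_end k (Block p' q' i' j')"
  shows "p = p' \<and> q = q' \<and> i = i' \<and> j = j'"
  using assms
  by (cases p; cases q; cases p'; cases q') (simp_all add: ear_simps split: if_splits)

lemma ear_ends_Block_Horizontal:
  assumes "i < k" "j < k" "0 < i \<or> 0 < j" "0 < j'" "j' < k"
    and "ear_start k (Block p q i j) = ear_start k (Horizontal p' q' j')"
    and "ear_end k (Block p q i j) = ear_end k (Horizontal p' q' j')"
  shows False
  using assms
  by (cases p; cases q; cases p'; cases q') (simp_all add: ear_simps split: if_splits)

lemma ear_ends_Block_Vertical: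
  assumes "i < k" "j < k" "0 < i \<or> 0 < j" "0 < i'" "i' < k"
    and "ear_start k (Block p q i j) = ear_start k (Vertical p' q' i')"
    and "ear_end k (Block p q i j) = ear_end k (Vertical p' q' i')"
  shows False
  using assms
  by (cases p; cases q; cases p'; cases q') (simp_all add: ear_simps split: if_splits)

lemma inj_on_ear_base: "inj_on (ear_base k) (ears k)"
proof (rule inj_onI)
  fix e e'
  assume e: "e \<in> ears k" "e' \<in> ears k" and "ear_base k e = ear_base k e'"
  then have eq: "ear_start k e = ear_start k e'" "ear_end k e = ear_end k e'"
    using ear_base_eqD by blast+
  show "e = e'"
    using e(1)
  proof (cases rule: ears_cases)
    case (Block p q i j)
    show ?thesis
      using e(2)
    proof (cases rule: ears_cases)
      case Block': (Block p' q' i' j')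
      then show ?thesis
        using ear_ends_Block_inj[OF Block(2-) Block'(2-)] eq Block(1) by blast
    next
      case (Horizontal p' q' j')
      then show ?thesis using ear_ends_Block_Horizontal[OF Block(2-) Horizontal(2-)] eq Block(1) by blast
    next
      case (Vertical p' q' i')
      then show ?thesis using ear_ends_Block_Vertical[OF Block(2-) Vertical(2-)] eq Block(1) by blast
    qed
  next
    case (Horizontal p q j)
    show ?thesis
      using e(2)
    proof (cases rule: ears_cases)
      case (Block p' q' i' j')
      then show ?thesis
        using ear_ends_Block_Horizontal[OF Block(2-) Horizontal(2-)] eq Horizontal(1) by metis
    next
      case Horizontal': (Horizontal p' q' j')
      show ?thesis using eq Horizontal Horizontal' by (auto simp: ear_simps)
    next
      case (Vertical p' q' i')
      then show ?thesis using eq Horizontal by (auto simp: ear_simps)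
    qed
  next
    case (Vertical p q i)
    show ?thesis
      using e(2)
    proof (cases rule: ears_cases)
      case (Block p' q' i' j')
      then show ?thesis
        using ear_ends_Block_Vertical[OF Block(2-) Vertical(2-)] eq Vertical(1) by metis
    next
      case (Horizontal p' q' j')
      then show ?thesis using eq Vertical by (auto simp: ear_simps)
    next
      case Vertical': (Vertical p' q' i')
      show ?thesis using eq Vertical Vertical' by (auto simp: ear_simps)
    qed
  qed
qed



section \<open>Where the base edges come from\<close>

fun ear_source :: "nat \<Rightarrow> ear \<Rightarrow> ear" where
  "ear_source k (Block p q i j) = (case block_side p q i j of
       Right \<Rightarrow> (if Suc i = k then Horizontal p q j else Block p q (i + 1) j)
     | Below \<Rightarrow> Block p q i (j - 1)
     | Above \<Rightarrow> (if Suc j = k then Vertical p q i else Block p q i (j + 1))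
     | Column x \<Rightarrow> Block p q i (j - 1)
     | _ \<Rightarrow> Block p q (i - 1) j)"
| "ear_source k (Horizontal p q j) = Block (\<not> p) q 0 j"
| "ear_source k (Vertical p q i) = Block p (\<not> q) i 0"

text \<open>These are the four tour edges that are leaper moves only for
  \<open>k = 1\<close>.\<close>

lemma tour_wrap:
  "{cell k False False k False 0 True, cell k False False 0 True 0 True} \<in> cycle_edges tour"
  "{cell k False True k False 0 False, cell k False True 0 True 0 False} \<in> cycle_edges tour"
  "{cell k False True 0 False k False, cell k False True 0 False 0 True} \<in> cycle_edges tour"
  "{cell k True True 0 True k False, cell k True True 0 True 0 True} \<in> cycle_edges tour"
  if "0 < k"
  using that by (simp_all add: cycle_edges_def tour_def ear_simps doubleton_eq_iff)

lemma ear_base_in_source: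
  assumes "e \<in> ears k"
  shows "ear_base k e \<in> cycle_edges tour \<or> ear_source k e \<in> ears k \<and>
     ear_rank k (ear_source k e) < ear_rank k e \<and> ear_base k e \<in> ear_edges k (ear_source k e)"
  using assms
proof (cases rule: ears_cases)
  case (Block p q i j)
  show ?thesis
  \<comment> \<open>The condition singles out the first blocks of the two rows and two columns that
    are inserted into false edges. All other base edges lie in the ear given by
    \<open>ear_source\<close>.\<close>
  proof (cases "i = 0 \<and> j = 1 \<and> q \<or> i = 1 \<and> j = 0 \<and> \<not> p")
    case True
    then show ?thesis
      using Block tour_wrap[of k] by (cases p; cases q) (auto simp: ear_base_def Let_def)
  next
    case False
    have "ear_source k e \<in> ears k"
      using False Block by (cases p; cases q) auto
    moreover have "ear_rank k (ear_source k e) < ear_rank k e"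
      using False Block by (cases p; cases q) auto
    moreover have "ear_base k e \<in> ear_edges k (ear_source k e)"
      using False Block unfolding ear_base_def ear_edges_def
      by (cases p; cases q; cases "i = 0")
        (simp_all add: Let_def insert_commute le_Suc_eq split: if_splits)
    ultimately show ?thesis by blast
  qed
next
  case (Horizontal p q j)
  \<comment> \<open>At parity \<open>p\<close> the index \<open>k\<close> carries over to index 0 of
    the grid \<open>(\<not> p, q)\<close>, so the base edge is an edge of a block of that
    grid.\<close>
  then have "ear_base k e = {cell k (\<not> p) q 0 False j p, cell k (\<not> p) q 0 True j p}"
    by (auto simp: ear_base_def ear_simps)
  then show ?thesis
    using Horizontal by (cases p; cases q) (simp_all add: ear_edges_def Let_def insert_commute)
next
  case (Vertical p q i)
  then have "ear_base k e = {cell k p (\<not> q) i q 0 False, cell k p (\<not> q) i q 0 True}"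
    by (auto simp: ear_base_def ear_simps)
  then show ?thesis
    using Vertical by (cases p; cases q) (simp_all add: ear_edges_def Let_def insert_commute)
qed

section \<open>Which edges are moves of the leaper\<close>

definition coord_value :: "nat \<Rightarrow> coord \<Rightarrow> int" where
  "coord_value k v = (case v of (c, i, b) \<Rightarrow> 2 * int k * int c + 2 * int i + of_bool b)"

definition embed :: "nat \<Rightarrow> coord \<times> coord \<Rightarrow> int \<times> int" where
  "embed k = map_prod (coord_value k) (coord_value k)"

definition leaper_adjacent :: "nat \<Rightarrow> (coord \<times> coord) set \<Rightarrow> bool" where
  "leaper_adjacent k e \<longleftrightarrow> (\<forall>u v. e = {u, v} \<longrightarrow>
     (fst (embed k v) - fst (embed k u), snd (embed k v) - snd (embed k u)) \<in> leaper_moves 1 (2 * k))"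

lemma leaper_adjacentI:
  assumes "(fst (embed k v) - fst (embed k u), snd (embed k v) - snd (embed k u))
    \<in> leaper_moves 1 (2 * k)"
  shows "leaper_adjacent k {u, v}"
  using assms leaper_moves_uminus[OF assms] by (auto simp: leaper_adjacent_def doubleton_eq_iff)

lemma coord_value_coord [simp]:
  "coord_value k (coord k c i b) = 2 * int k * of_bool c + 2 * int i + of_bool b"
  by (auto simp: coord_def coord_value_def algebra_simps of_nat_diff)

text \<open>The homomorphism property of the grids. The indices need no bound, because the carry in
  \<open>coord\<close> preserves the value.\<close>

lemma leaper_adjacent_cell [simp]:
  "x \<noteq> x' \<Longrightarrow> leaper_adjacent k {cell k p q i x j y, cell k p q i x' j y}"
  "y \<noteq> y' \<Longrightarrow> leaper_adjacent k {cell k p q i x j y, cell k p q i x j y'}"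
  "i' = Suc i \<Longrightarrow> leaper_adjacent k {cell k p q i True j y, cell k p q i' False j y}"
  "i' = Suc i \<Longrightarrow> leaper_adjacent k {cell k p q i' False j y, cell k p q i True j y}"
  "j' = Suc j \<Longrightarrow> leaper_adjacent k {cell k p q i x j True, cell k p q i x j' False}"
  "j' = Suc j \<Longrightarrow> leaper_adjacent k {cell k p q i x j' False, cell k p q i x j True}"
  by (intro leaper_adjacentI;
      cases p; cases q; cases x; cases x'; cases y; cases y';
      simp add: cell_def embed_def leaper_moves_def)+

text \<open>Only the edge from a \<open>Row\<close> or \<open>Column\<close> block to the far end
  can be false. It is then the base edge of the next block, and for the last block it is a
  move.\<close>

lemma ear_edges_adjacent:
  assumes "e \<in> ears k" "f \<in> ear_edges k e"
  shows "leaper_adjacent k f \<or> f \<in> ear_base k ` ears k"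
  using assms(1)
proof (cases rule: ears_cases)
  case (Block p q i j)
  show ?thesis
  proof (cases "block_side p q i j")
    case (Row y)
    have f: "leaper_adjacent k f" if "f \<noteq> {cell k p q k False 0 y, cell k p q i True 0 y}"
      using that assms(2) Block Row side_Row[OF Row] unfolding ear_edges_def
      by (auto simp: Let_def)
    show ?thesis
    proof (cases "Suc i = k")
      case True
      then have "leaper_adjacent k {cell k p q k False 0 y, cell k p q i True 0 y}"
        by simp
      then show ?thesis using f by (metis rev_image_eqI)
    next
      case False
      then have "{cell k p q k False 0 y, cell k p q i True 0 y} = ear_base k (Block p q (Suc i) 0)"
        "Block p q (Suc i) 0 \<in> ears k"
        using Row Block by (cases p; cases q; auto simp: ear_base_def Let_def split: if_splits)+
      then show ?thesis using f by (metis rev_image_eqI)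
    qed
  next
    case (Column x)
    have f: "leaper_adjacent k f" if "f \<noteq> {cell k p q 0 x k False, cell k p q 0 x j True}"
      using that assms(2) Block Column side_Column[OF Column] unfolding ear_edges_def
      by (auto simp: Let_def)
    show ?thesis
    proof (cases "Suc j = k")
      case True
      then have "leaper_adjacent k {cell k p q 0 x k False, cell k p q 0 x j True}"
        by simp
      then show ?thesis using f by (metis rev_image_eqI)
    next
      case False
      then have "{cell k p q 0 x k False, cell k p q 0 x j True} = ear_base k (Block p q 0 (Suc j))"
        "Block p q 0 (Suc j) \<in> ears k"
        using Column Block by (cases p; cases q; auto simp: ear_base_def Let_def split: if_splits)+
      then show ?thesis using f by (metis rev_image_eqI)
    qed
  next
    case Left
    \<comment> \<open>This makes the truncated difference \<open>i - 1\<close> in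
      \<open>ear_path\<close> a true predecessor.\<close>
    then have "0 < i" using Block by (cases p; cases q) (auto split: if_splits)
    then show ?thesis using assms(2) Block Left unfolding ear_edges_def
      by (auto simp: Let_def)
  next
    case Below
    then have "0 < j" using Block by (cases p; cases q) (auto split: if_splits)
    then show ?thesis using assms(2) Block Below unfolding ear_edges_def
      by (auto simp: Let_def)
  qed (use assms(2) Block in \<open>auto simp: Let_def ear_edges_def\<close>)
qed (use assms(2) in \<open>auto simp: Let_def ear_edges_def\<close>)

text \<open>A knight's move changes one coordinate by 2, which here is a change of \<open>c\<close>
  by one, and the other by 1. It becomes a leaper move if the latter step only changes the
  parity.\<close>

lemma leaper_adjacent_literal [simp]:
  "x \<noteq> x' \<Longrightarrow> d' = Suc d \<or> d = Suc d' \<Longrightarrow> leaper_adjacent k {((c, i, x), (d, j, y)), ((c, i, x'), (d', j, y))}"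
  "y \<noteq> y' \<Longrightarrow> c' = Suc c \<or> c = Suc c' \<Longrightarrow> leaper_adjacent k {((c, i, x), (d, j, y)), ((c', i, x), (d, j, y'))}"
  by (intro leaper_adjacentI; cases x; cases x'; cases y; cases y';
      auto simp: coord_value_def embed_def leaper_moves_def algebra_simps)+

lemma tour_edges_adjacent:
  assumes "0 < k" "f \<in> cycle_edges tour"
  shows "leaper_adjacent k f \<or> f \<in> ear_base k ` ears k"
proof -
  \<comment> \<open>The false edges of the tour, each with the block into whose path it is replaced
    when \<open>k > 1\<close>.\<close>
  define W where "W = {(cell k False False k False 0 True, cell k False False 0 True 0 True, Block False False 1 0),
    (cell k False True k False 0 False, cell k False True 0 True 0 False, Block False True 1 0),
    (cell k False True 0 False k False, cell k False True 0 False 0 True, Block False True 0 1),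
    (cell k True True 0 True k False, cell k True True 0 True 0 True, Block True True 0 1)}"
  have *: "leaper_adjacent k f \<or> (\<exists>(u, v, e)\<in>W. f = {u, v})"
    using assms unfolding cycle_edges_def tour_def
    by simp (elim disjE; simp add: W_def ear_simps doubleton_eq_iff)
  show ?thesis
  proof (cases "k = 1")
    case True
    have "leaper_adjacent k {u, v}" if "(u, v, e) \<in> W" for u v e
      using that True unfolding W_def by (auto)
    then show ?thesis using * by blast
  next
    case False
    then have "{u, v} = ear_base k e \<and> e \<in> ears k" if "(u, v, e) \<in> W" for u v e
      using that assms(1) unfolding W_def by (auto simp: ear_base_def Let_def)
    then show ?thesis using * by blast
  qed
qed

section \<open>The ears and the tour cover the board\<close>

definition coords :: "nat \<Rightarrow> coord set" where
  "coords k = {(c, i, b) | c i b. i < k \<and> (c < 2 \<or> c = 2 \<and> i = 0)}"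

text \<open>Division with remainder, first by \<open>2 k\<close> and then by 2; the last quotient
  \<open>c = 2\<close> leaves only two values.\<close>

lemma bij_betw_coord_value:
  assumes "0 < k"
  shows "bij_betw (coord_value k) (coords k) {0..<int (4 * k + 2)}"
proof (intro bij_betw_imageI)
  show "inj_on (coord_value k) (coords k)"
  proof (rule inj_onI)
    fix u v
    assume uv: "u \<in> coords k" "v \<in> coords k" "coord_value k u = coord_value k v"
    obtain c i b c' i' b' where *: "u = (c, i, b)" "v = (c', i', b')"
      by (cases u; cases v) auto
    have c: "c = 0 \<or> c = 1 \<or> c = 2" "c' = 0 \<or> c' = 1 \<or> c' = 2"
      and i: "i < k" "i' < k" "c = 2 \<longrightarrow> i = 0" "c' = 2 \<longrightarrow> i' = 0"
      using uv(1,2) * by (auto simp: coords_def less_2_cases_iff)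
    have eq: "2 * (int k * int c + int i) + of_bool b = 2 * (int k * int c' + int i') + of_bool b'"
      using uv(3) * by (simp add: coord_value_def algebra_simps)
    have "b = b'"
      using arg_cong[OF eq, of odd] by simp
    then have "int k * int c + int i = int k * int c' + int i'"
      using eq by simp
    then have "c = c' \<and> i = i'"
      using c i by (elim disjE) auto
    then show "u = v" using * \<open>b = b'\<close> by simp
  qed
next
  have "n \<in> coord_value k ` coords k" if "0 \<le> n" "n < 4 * int k + 2" for n
  proof -
    define c where "c = (if n < 2 * int k then 0 else if n < 4 * int k then 1 else 2 :: nat)"
    define m where "m = n - 2 * int k * int c"
    have m: "0 \<le> m" "m < (if c = 2 then 2 else 2 * int k)"
      using that by (auto simp: m_def c_def)
    have "n = coord_value k (c, nat (m div 2), odd m)"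
    proof -
      have "m = 2 * (m div 2) + of_bool (odd m)" by (cases "odd m") simp_all
      then show ?thesis using m(1) m_def by (simp add: coord_value_def)
    qed
    moreover have "(c, nat (m div 2), odd m) \<in> coords k"
      using m assms by (auto simp: coords_def c_def split: if_splits)
    ultimately show ?thesis by blast
  qed
  moreover have "coord_value k v \<in> {0..<4 * int k + 2}" if "v \<in> coords k" for v
    using that assms by (auto simp: coords_def coord_value_def less_2_cases_iff)
  ultimately have "coord_value k ` coords k = {0..<4 * int k + 2}" by auto
  then show "coord_value k ` coords k = {0..<int (4 * k + 2)}" by (simp add: add.commute)
qed

lemma cell_in_Block: "cell k p q i x j y \<in> set (ear_inner k (Block p q i j))"
proof (cases "block_side p q i j")
  case (Row y')
  then show ?thesis using side_Row[OF Row] by (cases x; cases y; cases y') (simp_all add: Let_def)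
next
  case (Column x')
  then show ?thesis using side_Column[OF Column]
    by (cases x; cases y; cases x') (simp_all add: Let_def)
qed (cases x; cases y; simp add: Let_def)+

text \<open>The 36 cells with both indices 0 form the tour. Any other cell is a new cell of the ear
  that \<open>ear_of\<close> assigns to it.\<close>

lemma ears_cover:
  assumes "0 < k"
  shows "set tour \<union> (\<Union>e\<in>ears k. set (ear_inner k e)) = coords k \<times> coords k"
proof
  have "v \<in> coords k \<times> coords k" if e: "e \<in> ears k" "v \<in> set (ear_inner k e)" for e v
    using e(1)
  proof (cases rule: ears_cases)
    case (Block p q i j)
    then obtain x y where "v = cell k p q i x j y"
      using ear_inner_Block e(2) by metis
    then show ?thesis using Block by (auto simp: ear_simps coords_def)
  qed (use e(2) assms in \<open>auto simp: ear_simps coords_def\<close>)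
  moreover have "set tour \<subseteq> coords k \<times> coords k"
    using assms by (auto simp: tour_def coords_def)
  ultimately show "set tour \<union> (\<Union>e\<in>ears k. set (ear_inner k e)) \<subseteq> coords k \<times> coords k"
    by blast
  show "coords k \<times> coords k \<subseteq> set tour \<union> (\<Union>e\<in>ears k. set (ear_inner k e))"
  proof clarify
    fix c i x d j y
    assume v: "(c, i, x) \<in> coords k" "(d, j, y) \<in> coords k"
      "((c, i, x), (d, j, y)) \<notin> (\<Union>e\<in>ears k. set (ear_inner k e))"
    have "i = 0 \<and> j = 0"
    proof (rule ccontr)
      assume *: "\<not> (i = 0 \<and> j = 0)"
      have "\<exists>e\<in>ears k. ((c, i, x), (d, j, y)) \<in> set (ear_inner k e)"
      proof (cases "c = 2 \<or> d = 2")
        \<comment> \<open>If \<open>c = 2\<close> then \<open>i = 0\<close>, so \<open>j\<close> is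
          positive and \<open>d\<close> is below 2; the other case is symmetric. The witnesses are
          those of \<open>ear_of\<close>.\<close>
        case True
        then show ?thesis
        proof
          assume "c = 2"
          then show ?thesis using v(1,2) * assms
            by (intro bexI[of _ "Horizontal (\<not> y) ((d = 1) \<noteq> x) j"])
              (auto simp: coords_def ear_simps less_2_cases_iff)
        next
          assume "d = 2"
          then show ?thesis using v(1,2) * assms
            by (intro bexI[of _ "Vertical ((c = 1) \<noteq> y) (\<not> x) i"])
              (auto simp: coords_def ear_simps less_2_cases_iff)
        qed
      next
        case False
        let ?p = "(c = 1) \<noteq> y" and ?q = "(d = 1) \<noteq> x"
        have "((c, i, x), (d, j, y)) = cell k ?p ?q i x j y"
          using False v(1,2) by (auto simp: coords_def ear_simps less_2_cases_iff)
        then have "((c, i, x), (d, j, y)) \<in> set (ear_inner k (Block ?p ?q i j))"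
          using cell_in_Block[of k ?p ?q i x j y] by simp
        moreover have "Block ?p ?q i j \<in> ears k"
          using v(1,2) * by (auto simp: coords_def)
        ultimately show ?thesis by blast
      qed
      then show False using v(3) by blast
    qed
    then show "((c, i, x), (d, j, y)) \<in> set tour"
      using v(1,2) by (cases x; cases y) (auto simp: coords_def tour_def less_2_cases_iff)
  qed
qed

section \<open>From spanning cycles to cycles of the digraph\<close>

lemma cas_zip: "pre_digraph.cas (with_proj G) x (zip (x # xs) (xs @ [z])) z"
  by (induction xs arbitrary: x) (auto simp: pre_digraph.cas.simps)

lemma awalk_verts_zip:
  "pre_digraph.awalk_verts (with_proj G) x (zip (x # xs) (xs @ [z])) = x # xs @ [z]"
  by (induction xs arbitrary: x) (auto simp: pre_digraph.awalk_verts.simps)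

lemma zip_path_edges: "(a, b) \<in> set (zip (x # xs) (xs @ [z])) \<Longrightarrow> {a, b} \<in> path_edges (x # xs @ [z])"
  by (induction xs arbitrary: x) auto

text \<open>An arc of \<open>with_proj G\<close> is the pair of its ends, so the closed walk is the
  vertex list zipped with its shift. The premise on unordered pairs supplies the arcs in either
  direction.\<close>

lemma hamiltonian_if_spanning_cycle:
  assumes cyc: "spanning_cycle V E" and f: "bij_betw f V (pverts G)"
    and arcs: "\<And>u v. {u, v} \<in> E \<Longrightarrow> (f u, f v) \<in> parcs G"
  shows "hamiltonian (with_proj G)"
proof -
  obtain p where p: "distinct p" "3 \<le> length p" "set p = V" "cycle_edges p = E"
    using cyc by (auto simp: spanning_cycle_def)
  then obtain x xs where px: "p = x # xs" by (cases p) auto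
  define q where "q = zip (f x # map f xs) (map f xs @ [f x])"
  have q: "q = map (map_prod f f) (zip (x # xs) (xs @ [x]))"
    using zip_map_map[of f "x # xs" f "xs @ [x]"] by (simp add: q_def map_prod_def)
  have "path_edges (x # xs @ [x]) = E"
    using p(4) path_edges_append[of p "[x]"] px by (simp add: cycle_edges_def)
  then have "set q \<subseteq> parcs G"
    using arcs zip_path_edges[of _ _ x xs x] unfolding q by fastforce
  moreover have verts: "f ` set p = pverts G"
    using f p(3) by (simp add: bij_betw_def)
  ultimately have walk: "pre_digraph.awalk (with_proj G) (f x) q (f x)"
    using cas_zip[of G "f x" "map f xs" "f x"] px by (auto simp: pre_digraph.awalk_def q_def)
  have "distinct (map f p)"
    using f p(1,3) by (simp add: distinct_map bij_betw_def)
  then have "pre_digraph.cycle (with_proj G) q"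
    using walk awalk_verts_zip[of G "f x" "map f xs" "f x"] px
    by (auto simp: pre_digraph.cycle_def q_def intro!: exI[of _ "f x"])
  moreover have "3 \<le> length q" using p(2) px by (simp add: q_def)
  moreover have "map fst q = map f p" using px by (simp add: q_def map_fst_zip)
  then have "fst ` set q = pverts G" using verts by (metis list.set_map)
  ultimately show ?thesis unfolding hamiltonian_def by (intro exI[of _ q]) simp
qed

theorem theorem5:
  fixes k :: nat
  assumes "0 < k"
  shows "hamiltonian (with_proj (leaper_graph 1 (2 * k) (4 * k + 2) (4 * k + 2)))"
proof -
  let ?V = "set tour \<union> (\<Union>e\<in>ears k. set (ear_inner k e))"
  let ?E = "(cycle_edges tour \<union> (\<Union>e\<in>ears k. ear_edges k e)) - ear_base k ` ears k"
  let ?G = "leaper_graph 1 (2 * k) (4 * k + 2) (4 * k + 2)"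
  have "spanning_cycle ?V ?E"
    unfolding ear_edges_def ear_base_def
  proof (rule spanning_cycle_add_ears[where r = "ear_rank k"])
    show "finite (ears k)" by (rule finite_ears)
    show "spanning_cycle (set tour) (cycle_edges tour)" by (rule spanning_cycle_tour)
    show "inj_on (\<lambda>e. {ear_start k e, ear_end k e}) (ears k)"
      using inj_on_ear_base by (simp add: inj_on_def ear_base_def)
  next
    fix e
    assume e: "e \<in> ears k"
    show "ear_inner k e \<noteq> [] \<and> distinct (ear_inner k e) \<and> set (ear_inner k e) \<inter> set tour = {}"
      using ear_inner_distinct[of k e] inner_nonzero[OF e] tour_zero by fastforce
    show "{ear_start k e, ear_end k e} \<in> cycle_edges tour \<or>
      (\<exists>e'\<in>ears k. ear_rank k e' < ear_rank k e \<and> {ear_start k e, ear_end k e} \<in>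
         path_edges (ear_start k e' # ear_inner k e' @ [ear_end k e']))"
      using ear_base_in_source[OF e] unfolding ear_base_def ear_edges_def by blast
  next
    fix e e'
    assume "e \<in> ears k" "e' \<in> ears k" "e \<noteq> e'"
    then show "set (ear_inner k e) \<inter> set (ear_inner k e') = {}"
      using ear_of_inner by blast
  qed
  then have cyc: "spanning_cycle (coords k \<times> coords k) ?E"
    unfolding ears_cover[OF assms] .
  have verts: "pverts ?G = {0..<int (4 * k + 2)} \<times> {0..<int (4 * k + 2)}"
    by (simp add: leaper_graph_def Let_def)
  have bij: "bij_betw (embed k) (coords k \<times> coords k) (pverts ?G)"
    unfolding embed_def verts using bij_betw_coord_value[OF assms] by (intro bij_betw_map_prod)
  show ?thesis
  proof (rule hamiltonian_if_spanning_cycle[OF cyc bij])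
    fix u v
    assume uv: "{u, v} \<in> ?E"
    \<comment> \<open>An edge that is not a move would be a base edge, and those are excluded from
      \<open>?E\<close>.\<close>
    then have "leaper_adjacent k {u, v}"
      using ear_edges_adjacent tour_edges_adjacent[OF assms] by blast
    then have "(fst (embed k v) - fst (embed k u), snd (embed k v) - snd (embed k u))
        \<in> leaper_moves 1 (2 * k)"
      unfolding leaper_adjacent_def by blast
    moreover have "u \<in> coords k \<times> coords k" "v \<in> coords k \<times> coords k"
      using spanning_cycle_edge_subset[OF cyc uv] by auto
    then have "embed k u \<in> pverts ?G" "embed k v \<in> pverts ?G"
      using bij by (auto simp: bij_betw_def)
    ultimately show "(embed k u, embed k v) \<in> parcs ?G"
      by (simp add: in_parcs_leaper_graph)
  qed
qed

end
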